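(* Let $V = \mathbb{R}^n$, $d \ge 1$, and nonnegative integers $a_1, \dots, a_d$. Let $\mathcal{F} = \{(A_i^{(1)}, \dots, A_i^{(d)}) \mid i \in [m]\}$ be a family of $d$-tuples of linear subspaces $A_i^{(k)} \le V$ such that: (i) $\dim(A_i^{(k)}) = a_k$ for every $i \in [m]$ and $k \in [d]$; (ii) $\dim(A_i^{(1)} + \cdots + A_i^{(d)}) = \dim(A_i^{(1)}) + \cdots + \dim(A_i^{(d)})$ for every $i \in [m]$; (iii) for any $i < j$ in $[m]$ there exist $p < q$ in $[d]$ with $A_i^{(p)} \cap A_j^{(q)} \ne \{0\}$. Then $$m \le \binom{a_1 + \cdots + a_d}{a_1, \dots, a_d}.$$
   Context: $\binom{a_1+\cdots+a_d}{a_1,\dots,a_d} = \frac{(a_1+\cdots+a_d)!}{a_1!\cdots a_d!}$ is the multinomial coefficient. (A family satisfying (ii) and (iii) is called a skew Bollobás system of $d$-tuples of spaces.) *)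

theory Defs
  imports "HOL-Analysis.Analysis"
begin

definition multinomial_coeff :: "nat \<Rightarrow> (nat \<Rightarrow> nat) \<Rightarrow> nat" where
  "multinomial_coeff d a = fact (\<Sum>k = 1..d. a k) div (\<Prod>k = 1..d. fact (a k))"

text \<open>The division in the definition is exact:\<close>

lemma prod_fact_dvd_fact_sum:
  fixes a :: "nat \<Rightarrow> nat"
  shows "(\<Prod>k = 1..d. fact (a k)) dvd (fact (\<Sum>k = 1..d. a k) :: nat)"
proof (induction d)
  case 0
  show ?case by simp
next
  case (Suc d)
  let ?s = "\<Sum>k = 1..d. a k"
  have "(\<Prod>k = 1..Suc d. fact (a k)) dvd (fact ?s * fact (a (Suc d)) :: nat)"
    using mult_dvd_mono[OF Suc.IH dvd_refl[of "fact (a (Suc d)) :: nat"]] by simp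
  also have "\<dots> dvd fact (?s + a (Suc d))"
    by (rule fact_fact_dvd_fact)
  finally show ?case by simp
qed

lemma of_nat_multinomial_coeff:
  fixes a :: "nat \<Rightarrow> nat"
  shows "real (multinomial_coeff d a) = fact (\<Sum>k = 1..d. a k) / (\<Prod>k = 1..d. fact (a k))"
  using real_of_nat_div[OF prod_fact_dvd_fact_sum[where d = d and a = a]]
  by (simp add: multinomial_coeff_def)

text \<open>A finite sum of sets \<open>\<Sum>k = 1..d. B k\<close> is the elementwise (Minkowski) sum of
  \<open>HOL-Library.Set_Algebras\<close>; for linear subspaces this is the sum of subspaces:\<close>

lemma sum_of_sets_eq:
  fixes B :: "nat \<Rightarrow> 'v::real_vector set"
  shows "(\<Sum>k = 1..d. B k) = {\<Sum>k = 1..d. x k |x. \<forall>k\<in>{1..d}. x k \<in> B k}"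
  by (auto simp: set_sum_alt)

end

theory Submission
  imports Defs "Jordan_Normal_Form.Determinant"
begin

text \<open>For each \<open>p\<close>, project \<open>V\<close> to dimension \<open>a\<^sub>p + \<dots> + a\<^sub>d\<close> by a linear map that is injective
  on all the spaces \<open>A\<^sub>i\<^sup>p + \<dots> + A\<^sub>i\<^sup>d\<close>, and let \<open>F\<^sub>p(i, j)\<close> be the determinant of the projections of
  a basis of \<open>A\<^sub>i\<^sup>p\<close> followed by a basis of \<open>A\<^sub>j\<^sup>p\<^sup>+\<^sup>1 + \<dots> + A\<^sub>j\<^sup>d\<close>. It is nonzero for \<open>i = j\<close>, and it
  vanishes as soon as \<open>A\<^sub>i\<^sup>p\<close> meets some \<open>A\<^sub>j\<^sup>q\<close> with \<open>q > p\<close>. Hence the entrywise product of the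
  \<open>m \<times> m\<close> matrices \<open>F\<^sub>p\<close> is triangular with nonzero diagonal and has rank \<open>m\<close>. On the other hand
  the rank of \<open>F\<^sub>p\<close> is at most \<open>(a\<^sub>p + \<dots> + a\<^sub>d) choose a\<^sub>p\<close>, ranks are submultiplicative under
  entrywise products, and the product of these binomial coefficients is the multinomial one.\<close>

no_notation Matrix.scalar_prod (infix \<open>\<bullet>\<close> 70)

section \<open>Rank and entrywise products\<close>

text \<open>Rank is encoded as a sum of \<open>N\<close> products of a function of \<open>i\<close>
  and a function of \<open>j\<close>, so that entrywise products and expanded determinants can be
  bounded directly, over any index set.\<close>

definition rank_le :: "'i set \<Rightarrow> nat \<Rightarrow> ('i \<Rightarrow> 'i \<Rightarrow> real) \<Rightarrow> bool" where
  "rank_le I N F \<longleftrightarrow> (\<exists>g h. \<forall>i\<in>I. \<forall>j\<in>I. F i j = (\<Sum>k<N. g k i * h k j))"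

text \<open>Rank-one terms arise indexed by pairs or by sets of rows; this renumbers them and allows
  fewer than \<open>N\<close>.\<close>

lemma rank_leI:
  assumes "finite S" "card S \<le> N"
    and "\<And>i j. i \<in> I \<Longrightarrow> j \<in> I \<Longrightarrow> F i j = (\<Sum>s\<in>S. g s i * h s j)"
  shows "rank_le I N F"
proof -
  obtain f where f: "bij_betw f {..<card S} S"
    using ex_bij_betw_nat_finite[OF assms(1)] by (auto simp: atLeast0LessThan)
  \<comment> \<open>The padding sits in \<open>g\<close> alone: for \<open>k\<close> beyond
    \<open>card S\<close> the factor \<open>h (f k)\<close> is arbitrary but gets multiplied by
    0.\<close>
  let ?g = "\<lambda>k i. if k < card S then g (f k) i else 0"
  have *: "F i j = (\<Sum>k<N. ?g k i * h (f k) j)" if "i \<in> I" "j \<in> I" for i j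
  proof -
    have "F i j = (\<Sum>k<card S. g (f k) i * h (f k) j)"
      using assms(3)[OF that] sum.reindex_bij_betw[OF f, of "\<lambda>s. g s i * h s j"] by simp
    also have "\<dots> = (\<Sum>k<N. ?g k i * h (f k) j)"
      using assms(2) by (intro sum.mono_neutral_cong_left) auto
    finally show ?thesis .
  qed
  show ?thesis
    unfolding rank_le_def
    by (intro exI[of _ ?g] exI[of _ "\<lambda>k j. h (f k) j"] ballI) (rule *)
qed

text \<open>Multiplying out two sums of rank-one terms gives one rank-one term for each pair of
  indices.\<close>

lemma rank_le_mult:
  assumes "rank_le I M F" "rank_le I N G"
  shows "rank_le I (M * N) (\<lambda>i j. F i j * G i j)"
proof -
  obtain g h where F: "\<And>i j. i \<in> I \<Longrightarrow> j \<in> I \<Longrightarrow> F i j = (\<Sum>k<M. g k i * h k j)"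
    using assms(1) unfolding rank_le_def by metis
  obtain g' h' where G: "\<And>i j. i \<in> I \<Longrightarrow> j \<in> I \<Longrightarrow> G i j = (\<Sum>k<N. g' k i * h' k j)"
    using assms(2) unfolding rank_le_def by metis
  show ?thesis
  proof (rule rank_leI[where S = "{..<M} \<times> {..<N}"
        and g = "\<lambda>(k, l) i. g k i * g' l i" and h = "\<lambda>(k, l) j. h k j * h' l j"])
    show "F i j * G i j = (\<Sum>s\<in>{..<M} \<times> {..<N}.
        (case s of (k, l) \<Rightarrow> \<lambda>i. g k i * g' l i) i * (case s of (k, l) \<Rightarrow> \<lambda>j. h k j * h' l j) j)"
      if "i \<in> I" "j \<in> I" for i j
      unfolding F[OF that] G[OF that] sum_product sum.cartesian_product
      by (intro sum.cong) (auto simp: ac_simps)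
  qed auto
qed

lemma rank_le_prod:
  assumes "finite P" "\<And>p. p \<in> P \<Longrightarrow> rank_le I (N p) (F p)"
  shows "rank_le I (\<Prod>p\<in>P. N p) (\<lambda>i j. \<Prod>p\<in>P. F p i j)"
  using assms
proof (induction P rule: finite_induct)
  case empty
  show ?case
    unfolding rank_le_def by (intro exI[of _ "\<lambda>_ _. 1"]) auto
next
  case (insert p P)
  then show ?case
    using rank_le_mult[of I "N p" "F p" "\<Prod>p\<in>P. N p"] by simp
qed

text \<open>A triangular matrix with nonzero diagonal is invertible, whereas a factorization through
  fewer than \<open>m\<close> dimensions forces determinant 0.\<close>

lemma triangular_rank_ge:
  assumes "rank_le {1..m} N F"
    and zero: "\<And>i j. i \<in> {1..m} \<Longrightarrow> j \<in> {1..m} \<Longrightarrow> i < j \<Longrightarrow> F i j = 0"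
    and diag: "\<And>i. i \<in> {1..m} \<Longrightarrow> F i i \<noteq> 0"
  shows "m \<le> N"
proof (rule ccontr)
  assume "\<not> m \<le> N"
  then have Nm: "N < m" by simp
  obtain g h where F: "\<And>i j. i \<in> {1..m} \<Longrightarrow> j \<in> {1..m} \<Longrightarrow> F i j = (\<Sum>k<N. g k i * h k j)"
    using assms(1) unfolding rank_le_def by metis
  \<comment> \<open>\<open>Suc\<close> passes from matrix indices starting at 0 to
    \<open>{1..m}\<close>. Zero columns pad \<open>G\<close> to a square matrix, so that the
    determinant is multiplicative on \<open>G * H\<close>.\<close>
  define M where "M = mat m m (\<lambda>(i, j). F (Suc i) (Suc j))"
  define G where "G = mat m m (\<lambda>(i, k). if k < N then g k (Suc i) else 0)"
  define H where "H = mat m m (\<lambda>(k, j). h k (Suc j))"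
  have c: "M \<in> carrier_mat m m" "G \<in> carrier_mat m m" "H \<in> carrier_mat m m"
    by (auto simp: M_def G_def H_def)
  have "M = G * H"
  proof (rule eq_matI)
    fix i j assume ij: "i < dim_row (G * H)" "j < dim_col (G * H)"
    then have ij: "i < m" "j < m" using c by auto
    have "M $$ (i, j) = (\<Sum>k<N. g k (Suc i) * h k (Suc j))"
      using ij F[of "Suc i" "Suc j"] by (simp add: M_def)
    also have "\<dots> = (\<Sum>k<m. (if k < N then g k (Suc i) else 0) * h k (Suc j))"
      using Nm by (intro sum.mono_neutral_cong_left) auto
    also have "\<dots> = (G * H) $$ (i, j)"
      using ij by (simp add: G_def H_def scalar_prod_def atLeast0LessThan)
    finally show "M $$ (i, j) = (G * H) $$ (i, j)" .
  qed (use c in auto)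
  then have "det M = det G * det H"
    using c det_mult by metis
  moreover have "det G = 0"
  proof -
    \<comment> \<open>Column \<open>N\<close> of \<open>G\<close> is padding, so this unit vector
      lies in the kernel.\<close>
    have "G *\<^sub>v unit_vec m N = 0\<^sub>v m"
      using Nm by (intro eq_vecI) (auto simp: G_def)
    moreover have "unit_vec m N \<noteq> (0\<^sub>v m :: real vec)"
      using Nm by (metis index_unit_vec(1) index_zero_vec(1) zero_neq_one)
    ultimately show ?thesis
      using det_0_iff_vec_prod_zero_field[OF c(2)] by (metis unit_vec_carrier)
  qed
  moreover have "det M = prod_list (diag_mat M)"
    using zero by (intro det_lower_triangular[OF _ c(1)]) (auto simp: M_def)
  moreover have "prod_list (diag_mat M) \<noteq> 0"
    using diag by (auto simp: prod_list_zero_iff diag_mat_def M_def)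
  ultimately show False by simp
qed

section \<open>Determinants split into two blocks of columns\<close>

text \<open>The permutations mapping the first block onto \<open>S\<close> form the coset of
  \<open>\<rho>\<close> modulo the stabilizer of that block, and the stabilizer is the product of
  the symmetric groups of the two blocks.\<close>

lemma bij_betw_permutes_block:
  fixes \<rho> :: "nat \<Rightarrow> nat"
  assumes \<rho>: "\<rho> permutes {0..<a + b}" and S: "\<rho> ` {..<a} = S"
  shows "bij_betw (\<lambda>(\<sigma>, \<tau>). \<rho> \<circ> (\<sigma> \<circ> \<tau>))
    ({\<sigma>. \<sigma> permutes {..<a}} \<times> {\<tau>. \<tau> permutes {a..<a + b}})
    {\<pi>. \<pi> permutes {0..<a + b} \<and> \<pi> ` {..<a} = S}"
\<comment> \<open>The inverse restricts the permutation "\<open>\<pi>\<close>, then the inverse of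
  \<open>\<rho>\<close>" to each of the two blocks and extends it by the identity.\<close>
proof (rule bij_betwI[where g = "\<lambda>\<pi>. (\<lambda>l. if l < a then inv_into UNIV \<rho> (\<pi> l) else l,
      \<lambda>l. if l < a then l else inv_into UNIV \<rho> (\<pi> l))"])
  have inv: "inv_into UNIV \<rho> (\<rho> x) = x" "\<rho> (inv_into UNIV \<rho> x) = x" for x
    using \<rho> by (simp_all add: permutes_inverses)
  have high: "\<tau> l < a \<longleftrightarrow> l < a" if "\<tau> permutes {a..<a + b}" for \<tau> l
    using permutes_in_image[OF that, of l] permutes_not_in[OF that, of l] by (cases "l < a") auto
  show "(\<lambda>(\<sigma>, \<tau>). \<rho> \<circ> (\<sigma> \<circ> \<tau>)) \<in> {\<sigma>. \<sigma> permutes {..<a}} \<times> {\<tau>. \<tau> permutes {a..<a + b}} \<rightarrow>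
    {\<pi>. \<pi> permutes {0..<a + b} \<and> \<pi> ` {..<a} = S}"
  proof (clarsimp, intro conjI)
    fix \<sigma> \<tau> assume st: "\<sigma> permutes {..<a}" "\<tau> permutes {a..<a + b}"
    have "\<sigma> permutes {0..<a + b}" "\<tau> permutes {0..<a + b}"
      by (rule permutes_subset[OF st(1)], auto) (rule permutes_subset[OF st(2)], auto)
    then show "\<rho> \<circ> (\<sigma> \<circ> \<tau>) permutes {0..<a + b}"
      using \<rho> by (intro permutes_compose)
    have "\<tau> ` {..<a} = {..<a}"
      using permutes_not_in[OF st(2)] by (auto simp: image_iff)
    then show "(\<lambda>x. \<rho> (\<sigma> (\<tau> x))) ` {..<a} = S"
      using permutes_image[OF st(1)] S by (metis image_image)
  qed
  show "(\<lambda>\<pi>. (\<lambda>l. if l < a then inv_into UNIV \<rho> (\<pi> l) else l, \<lambda>l. if l < a then l else inv_into UNIV \<rho> (\<pi> l))) \<in>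
    {\<pi>. \<pi> permutes {0..<a + b} \<and> \<pi> ` {..<a} = S} \<rightarrow>
    {\<sigma>. \<sigma> permutes {..<a}} \<times> {\<tau>. \<tau> permutes {a..<a + b}}"
  proof (clarsimp, intro conjI)
    fix \<pi> assume \<pi>: "\<pi> permutes {0..<a + b}" and \<pi>S: "S = \<pi> ` {..<a}"
    let ?\<kappa> = "\<lambda>l. inv_into UNIV \<rho> (\<pi> l)"
    have \<kappa>: "?\<kappa> permutes {0..<a + b}"
      using permutes_compose[OF \<pi> permutes_inv[OF \<rho>]] by (simp add: o_def)
    have im: "?\<kappa> ` {..<a} = {..<a}"
    proof -
      have "?\<kappa> ` {..<a} = inv_into UNIV \<rho> ` \<rho> ` {..<a}" using \<pi>S S by (simp add: image_image)
      then show ?thesis by (simp add: image_image inv)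
    qed
    have inj: "inj ?\<kappa>" using permutes_inj[OF \<kappa>] .
    \<comment> \<open>An injective map that preserves the whole range and the lower block also
      preserves the upper one.\<close>
    have "?\<kappa> ` ({0..<a + b} - {..<a}) = {0..<a + b} - {..<a}"
      using image_set_diff[OF inj, of "{0..<a + b}" "{..<a}"] permutes_image[OF \<kappa>] im by simp
    moreover have "{0..<a + b} - {..<a} = {a..<a + b}" by auto
    ultimately have im': "?\<kappa> ` {a..<a + b} = {a..<a + b}" by simp
    show "(\<lambda>l. if l < a then ?\<kappa> l else l) permutes {..<a}"
    proof (rule bij_imp_permutes)
      have "bij_betw ?\<kappa> {..<a} {..<a}"
        using inj im by (auto simp: bij_betw_def inj_def intro!: inj_onI)
      then show "bij_betw (\<lambda>l. if l < a then ?\<kappa> l else l) {..<a} {..<a}"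
        by (subst bij_betw_cong[where g = ?\<kappa>]) auto
    qed auto
    show "(\<lambda>l. if l < a then l else ?\<kappa> l) permutes {a..<a + b}"
    proof (rule bij_imp_permutes)
      have "bij_betw ?\<kappa> {a..<a + b} {a..<a + b}"
        using inj im' by (auto simp: bij_betw_def inj_def intro!: inj_onI)
      then show "bij_betw (\<lambda>l. if l < a then l else ?\<kappa> l) {a..<a + b} {a..<a + b}"
        by (subst bij_betw_cong[where g = ?\<kappa>]) auto
      show "(if l < a then l else ?\<kappa> l) = l" if "l \<notin> {a..<a + b}" for l
        using permutes_not_in[OF \<kappa>, of l] that by auto
    qed
  qed
  show "(\<lambda>l. if l < a then inv_into UNIV \<rho> (((\<lambda>(\<sigma>, \<tau>). \<rho> \<circ> (\<sigma> \<circ> \<tau>)) x) l) else l,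
     \<lambda>l. if l < a then l else inv_into UNIV \<rho> (((\<lambda>(\<sigma>, \<tau>). \<rho> \<circ> (\<sigma> \<circ> \<tau>)) x) l)) = x"
    if *: "x \<in> {\<sigma>. \<sigma> permutes {..<a}} \<times> {\<tau>. \<tau> permutes {a..<a + b}}" for x
  proof -
    obtain \<sigma> \<tau> where x: "x = (\<sigma>, \<tau>)" and st: "\<sigma> permutes {..<a}" "\<tau> permutes {a..<a + b}"
      using * by auto
    have "(\<lambda>l. if l < a then \<sigma> (\<tau> l) else l) = \<sigma>"
      using permutes_not_in[OF st(2)] permutes_not_in[OF st(1)] by auto
    moreover have "(\<lambda>l. if l < a then l else \<sigma> (\<tau> l)) = \<tau>"
      using permutes_not_in[OF st(2)] permutes_not_in[OF st(1)] high[OF st(2)]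
      by auto
    ultimately show ?thesis unfolding x by (simp add: inv cong: if_cong)
  qed
  show "(\<lambda>(\<sigma>, \<tau>). \<rho> \<circ> (\<sigma> \<circ> \<tau>)) (\<lambda>l. if l < a then inv_into UNIV \<rho> (\<pi> l) else l,
      \<lambda>l. if l < a then l else inv_into UNIV \<rho> (\<pi> l)) = \<pi>"
    if "\<pi> \<in> {\<pi>. \<pi> permutes {0..<a + b} \<and> \<pi> ` {..<a} = S}" for \<pi>
  proof -
    have \<pi>: "\<pi> ` {..<a} = S" "inj \<pi>" using that permutes_inj by auto
    \<comment> \<open>Indices outside the lower block stay outside it, so the first component of the
      pair fixes whatever the second one produces there.\<close>
    have "\<not> inv_into UNIV \<rho> (\<pi> l) < a" if "\<not> l < a" for l
    proof
      assume "inv_into UNIV \<rho> (\<pi> l) < a"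
      then have "\<pi> l \<in> \<pi> ` {..<a}" using S \<pi>(1) inv(2)[of "\<pi> l"] by (metis imageI lessThan_iff)
      then show False using \<pi>(2) that by (auto simp: inj_def)
    qed
    then show ?thesis by (auto simp: inv)
  qed
qed

text \<open>In the Leibniz formula, the permutations are grouped by the set of rows that they
  assign to the first \<open>a\<close> columns; each group factors into an \<open>X\<close>-part and a \<open>Y\<close>-part.\<close>

lemma det_blocks_rank_le:
  "rank_le I ((a + b) choose a)
    (\<lambda>i j. det (mat (a + b) (a + b) (\<lambda>(k, l). if l < a then X i k l else Y j k l)))"
proof -
  define P where "P = {\<pi>. \<pi> permutes {0..<a + b}}"
  \<comment> \<open>The row sets that the first \<open>a\<close> columns can receive; each has
    \<open>a\<close> elements, whence the binomial coefficient.\<close>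
  define \<S> where "\<S> = (\<lambda>\<pi>. \<pi> ` {..<a}) ` P"
  have finP: "finite P" unfolding P_def by (rule finite_permutations) simp
  then have fin: "finite \<S>" unfolding \<S>_def by simp
  have "\<S> \<subseteq> {S. S \<subseteq> {0..<a + b} \<and> card S = a}"
  proof -
    have "\<pi> ` {..<a} \<subseteq> {0..<a + b} \<and> card (\<pi> ` {..<a}) = a" if "\<pi> \<in> P" for \<pi>
    proof -
      have \<pi>: "\<pi> permutes {0..<a + b}" using that by (simp add: P_def)
      have "\<pi> ` {..<a} \<subseteq> \<pi> ` {0..<a + b}" by (intro image_mono) auto
      then show ?thesis
        using permutes_image[OF \<pi>] permutes_inj_on[OF \<pi>, of "{..<a}"] by (simp add: card_image)
    qed
    then show ?thesis unfolding \<S>_def by blast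
  qed
  then have card: "card \<S> \<le> (a + b) choose a"
    using n_subsets[of "{0..<a + b}" a] card_mono[of "{S. S \<subseteq> {0..<a + b} \<and> card S = a}" \<S>]
    by simp
  \<comment> \<open>A coset representative for each row set.\<close>
  define \<rho> where "\<rho> S = (SOME \<pi>. \<pi> \<in> P \<and> \<pi> ` {..<a} = S)" for S
  have \<rho>: "\<rho> S permutes {0..<a + b} \<and> \<rho> S ` {..<a} = S" if "S \<in> \<S>" for S
  proof -
    have "\<exists>\<pi>. \<pi> \<in> P \<and> \<pi> ` {..<a} = S" using that unfolding \<S>_def by auto
    from someI_ex[OF this] show ?thesis unfolding \<rho>_def P_def by simp
  qed
  \<comment> \<open>The sign is multiplicative along the coset decomposition; the constant sign of
    \<open>\<rho> S\<close> is absorbed into \<open>g\<close>.\<close>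
  define g where "g S i = (\<Sum>\<sigma> | \<sigma> permutes {..<a}.
      signof (\<rho> S) * (signof \<sigma> * (\<Prod>l<a. X i (\<rho> S (\<sigma> l)) l)))" for S i
  define h where "h S j = (\<Sum>\<tau> | \<tau> permutes {a..<a + b}.
      signof \<tau> * (\<Prod>l\<in>{a..<a + b}. Y j (\<rho> S (\<tau> l)) l))" for S j
  show ?thesis
  proof (rule rank_leI[OF fin card])
    fix i j assume "i \<in> I" "j \<in> I"
    define A where "A = mat (a + b) (a + b) (\<lambda>(k, l). if l < a then X i k l else Y j k l)"
    define t where "t \<pi> = signof \<pi> * (\<Prod>l<a + b. A $$ (\<pi> l, l))" for \<pi>
    have "det A = (\<Sum>\<pi>\<in>P. t \<pi>)"
      unfolding P_def t_def by (rule det_col) (simp add: A_def)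
    also have "\<dots> = (\<Sum>S\<in>\<S>. \<Sum>\<pi> | \<pi> \<in> P \<and> \<pi> ` {..<a} = S. t \<pi>)"
      using finP fin by (intro sum.group[symmetric]) (auto simp: \<S>_def)
    also have "\<dots> = (\<Sum>S\<in>\<S>. g S i * h S j)"
    proof (rule sum.cong[OF refl])
      fix S assume S: "S \<in> \<S>"
      note r = \<rho>[OF S]
      have "(\<Sum>\<pi> | \<pi> \<in> P \<and> \<pi> ` {..<a} = S. t \<pi>)
          = (\<Sum>(\<sigma>, \<tau>)\<in>{\<sigma>. \<sigma> permutes {..<a}} \<times> {\<tau>. \<tau> permutes {a..<a + b}}. t (\<rho> S \<circ> (\<sigma> \<circ> \<tau>)))"
        using sum.reindex_bij_betw[OF bij_betw_permutes_block[OF conjunct1[OF r] conjunct2[OF r]], of t]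
        by (simp add: P_def case_prod_unfold)
      also have "\<dots> = (\<Sum>(\<sigma>, \<tau>)\<in>{\<sigma>. \<sigma> permutes {..<a}} \<times> {\<tau>. \<tau> permutes {a..<a + b}}.
          signof (\<rho> S) * (signof \<sigma> * (\<Prod>l<a. X i (\<rho> S (\<sigma> l)) l))
            * (signof \<tau> * (\<Prod>l\<in>{a..<a + b}. Y j (\<rho> S (\<tau> l)) l)))"
      proof (rule sum.cong[OF refl], clarify)
        fix \<sigma> \<tau> assume st: "\<sigma> permutes {..<a}" "\<tau> permutes {a..<a + b}"
        have perm: "permutation (\<rho> S)" "permutation \<sigma>" "permutation \<tau>"
          using r st by (auto intro: permutation_permutes[THEN iffD2] finite_lessThan finite_atLeastLessThan)
        have rin: "\<rho> S l < a + b \<longleftrightarrow> l < a + b" for l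
          using permutes_in_image[OF conjunct1[OF r], of l] by simp
        have sin: "\<sigma> l < a" if "l < a" for l
          using permutes_in_image[OF st(1), of l] that by simp
        have tin: "a \<le> \<tau> l \<and> \<tau> l < a + b" if "a \<le> l" "l < a + b" for l
          using permutes_in_image[OF st(2), of l] that by simp
        have fixed: "\<sigma> (\<tau> l) = \<tau> l" if "a \<le> l" "l < a + b" for l
          using permutes_not_in[OF st(1), of "\<tau> l"] tin[OF that] by simp
        \<comment> \<open>Below \<open>a\<close> the permutation \<open>\<tau>\<close> is the
          identity; from \<open>a\<close> on, \<open>\<tau>\<close> stays in the upper block, which
          \<open>\<sigma>\<close> fixes. So the \<open>X\<close> columns see only
          \<open>\<sigma>\<close> and the \<open>Y\<close> columns only
          \<open>\<tau>\<close>.\<close>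
        have "(\<Prod>l<a + b. A $$ ((\<rho> S \<circ> (\<sigma> \<circ> \<tau>)) l, l))
            = (\<Prod>l<a. A $$ ((\<rho> S \<circ> (\<sigma> \<circ> \<tau>)) l, l))
              * (\<Prod>l\<in>{a..<a + b}. A $$ ((\<rho> S \<circ> (\<sigma> \<circ> \<tau>)) l, l))"
          by (subst prod.union_disjoint[symmetric]) (auto simp: ivl_disj_un)
        also have "(\<Prod>l<a. A $$ ((\<rho> S \<circ> (\<sigma> \<circ> \<tau>)) l, l)) = (\<Prod>l<a. X i (\<rho> S (\<sigma> l)) l)"
          using permutes_not_in[OF st(2)] sin
          by (intro prod.cong) (auto simp: A_def rin trans_less_add1)
        also have "(\<Prod>l\<in>{a..<a + b}. A $$ ((\<rho> S \<circ> (\<sigma> \<circ> \<tau>)) l, l))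
            = (\<Prod>l\<in>{a..<a + b}. Y j (\<rho> S (\<tau> l)) l)"
          by (intro prod.cong) (auto simp: A_def rin tin fixed)
        finally show "t (\<rho> S \<circ> (\<sigma> \<circ> \<tau>)) =
            signof (\<rho> S) * (signof \<sigma> * (\<Prod>l<a. X i (\<rho> S (\<sigma> l)) l))
            * (signof \<tau> * (\<Prod>l\<in>{a..<a + b}. Y j (\<rho> S (\<tau> l)) l))"
          using perm by (simp add: t_def sign_compose permutation_compose)
      qed
      also have "\<dots> = g S i * h S j"
        unfolding g_def h_def sum_product sum.cartesian_product ..
      finally show "(\<Sum>\<pi> | \<pi> \<in> P \<and> \<pi> ` {..<a} = S. t \<pi>) = g S i * h S j" .
    qed
    finally show "det (mat (a + b) (a + b) (\<lambda>(k, l). if l < a then X i k l else Y j k l))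
        = (\<Sum>S\<in>\<S>. g S i * h S j)"
      unfolding A_def .
  qed
qed

section \<open>Generic projections\<close>

text \<open>Each nonzero vector excludes only a hyperplane, and finitely many null sets do not cover
  the space.\<close>

lemma ex_nonorthogonal:
  fixes S :: "'v::euclidean_space set"
  assumes "finite S" "0 \<notin> S"
  shows "\<exists>k. \<forall>x\<in>S. k \<bullet> x \<noteq> 0"
proof -
  have "negligible (\<Union>x\<in>S. {k. x \<bullet> k = 0})"
  proof (rule negligible_Union)
    show "negligible T" if "T \<in> (\<lambda>x. {k. x \<bullet> k = 0}) ` S" for T
      using that assms(2) by (auto intro!: negligible_hyperplane)
  qed (use assms(1) in simp)
  then have "(\<Union>x\<in>S. {k. x \<bullet> k = 0}) \<noteq> UNIV"
    using non_negligible_UNIV by metis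
  then show ?thesis by (auto simp: inner_commute)
qed

text \<open>The \<open>t k\<close> are the coordinates of a linear map to dimension \<open>s\<close>
  that is injective on every \<open>W\<close>. By induction on \<open>s\<close>: one generic
  functional has a kernel that cuts down every nonzero \<open>W\<close>.\<close>

lemma generic_functionals:
  fixes \<W> :: "'v::euclidean_space set set"
  assumes "finite \<W>" "\<And>W. W \<in> \<W> \<Longrightarrow> subspace W" "\<And>W. W \<in> \<W> \<Longrightarrow> dim W \<le> s"
  shows "\<exists>t::nat \<Rightarrow> 'v. \<forall>W\<in>\<W>. \<forall>x\<in>W. (\<forall>k<s. t k \<bullet> x = 0) \<longrightarrow> x = 0"
  using assms
proof (induction s arbitrary: \<W>)
  case 0
  then have "W \<subseteq> {0}" if "W \<in> \<W>" for W
    using that dim_eq_0[of W] by auto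
  then show ?case by blast
next
  case (Suc s)
  define w where "w W = (SOME x. x \<in> W \<and> x \<noteq> 0)" for W :: "'v set"
  have w: "w W \<in> W \<and> w W \<noteq> 0" if W: "W \<in> \<W>" "\<not> W \<subseteq> {0}" for W
  proof -
    have "\<exists>x. x \<in> W \<and> x \<noteq> 0" using W(2) by blast
    then show ?thesis unfolding w_def by (rule someI_ex)
  qed
  have "\<exists>k. \<forall>x\<in>w ` {W\<in>\<W>. \<not> W \<subseteq> {0}}. k \<bullet> x \<noteq> 0"
    using Suc.prems(1) w by (intro ex_nonorthogonal) (simp, fastforce)
  then obtain k where k: "\<And>W. W \<in> \<W> \<Longrightarrow> \<not> W \<subseteq> {0} \<Longrightarrow> k \<bullet> w W \<noteq> 0" by blast
  define H where "H = {x. k \<bullet> x = 0}"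
  have H: "subspace H" unfolding H_def by (rule subspace_hyperplane)
  \<comment> \<open>A nonzero \<open>W\<close> loses the vector \<open>w W\<close> in passing to
    \<open>W \<inter> H\<close>, so its dimension drops and the induction hypothesis
    applies.\<close>
  have "\<exists>t. \<forall>W\<in>(\<lambda>W. W \<inter> H) ` \<W>. \<forall>x\<in>W. (\<forall>k<s. t k \<bullet> x = 0) \<longrightarrow> x = 0"
  proof (rule Suc.IH)
    fix W' assume "W' \<in> (\<lambda>W. W \<inter> H) ` \<W>"
    then obtain W where W: "W \<in> \<W>" "W' = W \<inter> H" by blast
    note sub = Suc.prems(2)[OF W(1)]
    show sub': "subspace W'" unfolding W(2) by (rule subspace_inter[OF sub H])
    show "dim W' \<le> s"
    proof (cases "W \<subseteq> {0}")
      case True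
      then have "W' \<subseteq> {0}" using W(2) by auto
      then have "dim W' = 0" using dim_eq_0 by blast
      then show ?thesis by (metis le0)
    next
      case False
      have "w W \<in> W" "w W \<notin> W'" using w[OF W(1) False] k[OF W(1) False] W(2) by (auto simp: H_def)
      then have "W' \<subset> W" using W(2) by blast
      then have "dim W' < dim W"
        using sub sub' by (intro dim_psubset) (simp add: span_eq_iff[THEN iffD2])
      then show ?thesis using Suc.prems(3)[OF W(1)] by simp
    qed
  qed (use Suc.prems(1) in simp)
  then obtain t where t': "\<forall>W\<in>(\<lambda>W. W \<inter> H) ` \<W>. \<forall>x\<in>W. (\<forall>k<s. t k \<bullet> x = 0) \<longrightarrow> x = 0" ..
  have t: "x = 0" if "W \<in> \<W>" "x \<in> W" "x \<in> H" "\<forall>k<s. t k \<bullet> x = 0" for W x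
    using bspec[OF bspec[OF t' imageI[OF that(1)]] IntI[OF that(2,3)]] that(4) by blast
  \<comment> \<open>The new functional takes the free last index \<open>s\<close>: its vanishing
    puts \<open>x\<close> into \<open>H\<close>, and the others finish.\<close>
  have "x = 0" if "W \<in> \<W>" "x \<in> W" and *: "\<forall>j<Suc s. (t(s := k)) j \<bullet> x = 0" for W x
  proof (rule t[OF that(1,2)])
    show "x \<in> H" using *[rule_format, of s] by (simp add: H_def)
    show "\<forall>k<s. t k \<bullet> x = 0" using * by (metis fun_upd_other less_SucI less_irrefl)
  qed
  then show ?case by blast
qed

section \<open>Determinants of projected bases and the matrix of a system of pairs\<close>

text \<open>Applying the matrix to a coefficient vector \<open>c\<close> projects the combination of
  the \<open>v l\<close> with these coefficients, so \<open>c\<close> is a kernel vector exactly if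
  all \<open>t k\<close> kill that combination.\<close>

lemma det_inner_eq_0_iff:
  fixes t v :: "nat \<Rightarrow> 'v::euclidean_space"
  shows "det (mat s s (\<lambda>(k, l). t k \<bullet> v l)) = 0 \<longleftrightarrow>
    (\<exists>c. (\<exists>l<s. c l \<noteq> 0) \<and> (\<forall>k<s. t k \<bullet> (\<Sum>l<s. c l *\<^sub>R v l) = 0))"
proof -
  define A where "A = mat s s (\<lambda>(k, l). t k \<bullet> v l)"
  have A: "A \<in> carrier_mat s s" by (simp add: A_def)
  have entry: "vec_index (A *\<^sub>v vec s c) k = t k \<bullet> (\<Sum>l<s. c l *\<^sub>R v l)" if "k < s" for c k
    using that by (simp add: A_def scalar_prod_def inner_sum_right atLeast0LessThan mult.commute)
  have "det A = 0 \<longleftrightarrow> (\<exists>x. x \<in> carrier_vec s \<and> x \<noteq> 0\<^sub>v s \<and> A *\<^sub>v x = 0\<^sub>v s)"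
    by (rule det_0_iff_vec_prod_zero_field[OF A])
  also have "\<dots> \<longleftrightarrow> (\<exists>c. vec s c \<noteq> 0\<^sub>v s \<and> A *\<^sub>v vec s c = 0\<^sub>v s)"
  proof safe
    fix x :: "real vec" assume "x \<in> carrier_vec s" "x \<noteq> 0\<^sub>v s" "A *\<^sub>v x = 0\<^sub>v s"
    moreover from this have "x = vec s (vec_index x)" by (intro eq_vecI) auto
    ultimately show "\<exists>c. vec s c \<noteq> 0\<^sub>v s \<and> A *\<^sub>v vec s c = 0\<^sub>v s" by metis
  qed (metis vec_carrier)
  also have "\<dots> \<longleftrightarrow> (\<exists>c. (\<exists>l<s. c l \<noteq> 0) \<and> (\<forall>k<s. t k \<bullet> (\<Sum>l<s. c l *\<^sub>R v l) = 0))"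
  proof -
    have *: "x = 0\<^sub>v s \<longleftrightarrow> (\<forall>k<s. vec_index x k = 0)" if "x \<in> carrier_vec s" for x :: "real vec"
      using that by (auto intro!: eq_vecI)
    have "A *\<^sub>v vec s c \<in> carrier_vec s" for c
      using A by (rule mult_mat_vec_carrier) simp
    then show ?thesis by (simp add: * entry)
  qed
  finally show ?thesis unfolding A_def .
qed

text \<open>Numbering a basis makes its vectors available as matrix columns.\<close>

lemma ex_indexed_basis:
  fixes U :: "'v::euclidean_space set"
  assumes "subspace U"
  shows "\<exists>u::nat \<Rightarrow> 'v. U = {\<Sum>l<dim U. c l *\<^sub>R u l | c. True} \<and>
    (\<forall>c. (\<Sum>l<dim U. c l *\<^sub>R u l) = 0 \<longrightarrow> (\<forall>l<dim U. c l = 0))"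
proof -
  obtain B where B: "B \<subseteq> U" "independent B" "U \<subseteq> span B" "card B = dim U"
    using basis_exists by blast
  have fin: "finite B" using B(2) by (rule independent_imp_finite)
  have span: "span B = U" using B assms by (metis span_subspace)
  obtain u where u: "bij_betw u {..<dim U} B"
    using ex_bij_betw_nat_finite[OF fin] B(4) by (auto simp: atLeast0LessThan)
  have re: "(\<Sum>x\<in>B. f x *\<^sub>R x) = (\<Sum>l<dim U. f (u l) *\<^sub>R u l)" for f
    using sum.reindex_bij_betw[OF u, of "\<lambda>x. f x *\<^sub>R x"] by simp
  \<comment> \<open>The inverse of the enumeration turns a coefficient sequence into a coefficient
    function on \<open>B\<close>.\<close>
  let ?i = "inv_into {..<dim U} u"
  have i: "?i (u l) = l" if "l < dim U" for l
    using u that by (auto simp: bij_betw_def)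
  have re': "(\<Sum>l<dim U. c l *\<^sub>R u l) = (\<Sum>x\<in>B. c (?i x) *\<^sub>R x)" for c
    unfolding re by (intro sum.cong) (auto simp: i)
  have "U = {\<Sum>l<dim U. c l *\<^sub>R u l | c. True}"
  proof
    show "U \<subseteq> {\<Sum>l<dim U. c l *\<^sub>R u l | c. True}"
      using span re by (auto simp: span_finite[OF fin])
    show "{\<Sum>l<dim U. c l *\<^sub>R u l | c. True} \<subseteq> U"
      using span re' by (auto simp: span_finite[OF fin])
  qed
  moreover have "c l = 0" if "(\<Sum>l<dim U. c l *\<^sub>R u l) = 0" "l < dim U" for c l
  proof -
    have "\<forall>x\<in>B. c (?i x) = 0"
      using independentD[OF B(2) fin subset_refl that(1)[unfolded re']] by simp
    moreover have "u l \<in> B" using u that(2) by (auto simp: bij_betw_def)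
    ultimately show ?thesis using i[OF that(2)] by force
  qed
  ultimately show ?thesis by blast
qed

text \<open>The entry is the determinant of a projected basis of \<open>U i\<close> next to one of
  \<open>W j\<close>: a common nonzero vector makes the columns dependent, and splitting them into
  an \<open>i\<close> block and a \<open>j\<close> block bounds the rank.\<close>

lemma bollobas_pair_matrix:
  fixes U W :: "'i \<Rightarrow> 'v::euclidean_space set"
  assumes "finite I"
    and U: "\<And>i. i \<in> I \<Longrightarrow> subspace (U i)" "\<And>i. i \<in> I \<Longrightarrow> dim (U i) = a"
    and W: "\<And>i. i \<in> I \<Longrightarrow> subspace (W i)" "\<And>i. i \<in> I \<Longrightarrow> dim (W i) = b"
    and disj: "\<And>i. i \<in> I \<Longrightarrow> U i \<inter> W i \<subseteq> {0}"
  shows "\<exists>F. rank_le I ((a + b) choose a) F \<and> (\<forall>i\<in>I. F i i \<noteq> 0) \<and>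
    (\<forall>i\<in>I. \<forall>j\<in>I. \<not> U i \<inter> W j \<subseteq> {0} \<longrightarrow> F i j = 0)"
proof -
  have "\<forall>i\<in>I. \<exists>u::nat \<Rightarrow> 'v. U i = {\<Sum>l<a. c l *\<^sub>R u l | c. True} \<and>
      (\<forall>c. (\<Sum>l<a. c l *\<^sub>R u l) = 0 \<longrightarrow> (\<forall>l<a. c l = 0))"
    using ex_indexed_basis[OF U(1)] U(2) by fastforce
  then obtain u where u: "\<forall>i\<in>I. U i = {\<Sum>l<a. c l *\<^sub>R u i l | c. True} \<and>
      (\<forall>c. (\<Sum>l<a. c l *\<^sub>R u i l) = (0::'v) \<longrightarrow> (\<forall>l<a. c l = 0))"
    by (rule bchoice[THEN exE])
  have "\<forall>i\<in>I. \<exists>w::nat \<Rightarrow> 'v. W i = {\<Sum>l<b. c l *\<^sub>R w l | c. True} \<and>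
      (\<forall>c. (\<Sum>l<b. c l *\<^sub>R w l) = 0 \<longrightarrow> (\<forall>l<b. c l = 0))"
    using ex_indexed_basis[OF W(1)] W(2) by fastforce
  then obtain w where w: "\<forall>i\<in>I. W i = {\<Sum>l<b. c l *\<^sub>R w i l | c. True} \<and>
      (\<forall>c. (\<Sum>l<b. c l *\<^sub>R w i l) = (0::'v) \<longrightarrow> (\<forall>l<b. c l = 0))"
    by (rule bchoice[THEN exE])
  have inU: "(\<Sum>l<a. c l *\<^sub>R u i l) \<in> U i" and U0: "(\<Sum>l<a. c l *\<^sub>R u i l) = 0 \<Longrightarrow> \<forall>l<a. c l = 0"
    if "i \<in> I" for c i
    using bspec[OF u that] by blast+
  have inW: "(\<Sum>l<b. c l *\<^sub>R w i l) \<in> W i" and W0: "(\<Sum>l<b. c l *\<^sub>R w i l) = 0 \<Longrightarrow> \<forall>l<b. c l = 0"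
    if "i \<in> I" for c i
    using bspec[OF w that] by blast+
  \<comment> \<open>The projection has to be injective only on the sums with equal indices, whose
    dimension is at most \<open>a + b\<close>.\<close>
  define E where "E i = {x + y | x y. x \<in> U i \<and> y \<in> W i}" for i
  have "\<exists>t::nat \<Rightarrow> 'v. \<forall>V\<in>E ` I. \<forall>x\<in>V. (\<forall>k<a + b. t k \<bullet> x = 0) \<longrightarrow> x = 0"
  proof (rule generic_functionals)
    show "subspace V" if "V \<in> E ` I" for V
      using that U(1) W(1) by (auto simp: E_def intro: subspace_sums)
    show "dim V \<le> a + b" if V: "V \<in> E ` I" for V
    proof -
      obtain i where i: "i \<in> I" "V = E i" using V by blast
      show ?thesis
        using dim_sums_Int[OF U(1)[OF i(1)] W(1)[OF i(1)]] U(2)[OF i(1)] W(2)[OF i(1)]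
        unfolding i(2) E_def by linarith
    qed
  qed (use assms(1) in simp)
  then obtain t :: "nat \<Rightarrow> 'v"
    where t': "\<forall>V\<in>E ` I. \<forall>x\<in>V. (\<forall>k<a + b. t k \<bullet> x = 0) \<longrightarrow> x = 0" ..
  have t: "x + y = 0" if "i \<in> I" "x \<in> U i" "y \<in> W i" "\<forall>k<a + b. t k \<bullet> (x + y) = 0" for i x y
  proof -
    have "x + y \<in> E i" using that(2,3) unfolding E_def by blast
    then show ?thesis using bspec[OF t' imageI[OF that(1)]] that(4) by blast
  qed
  define v where "v i j l = (if l < a then u i l else w j (l - a))" for i j l
  have comb: "(\<Sum>l<a + b. c l *\<^sub>R v i j l) = (\<Sum>l<a. c l *\<^sub>R u i l) + (\<Sum>l<b. c (a + l) *\<^sub>R w j l)"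
    for c i j
    by (induction b) (auto simp: v_def add.assoc)
  define F where "F i j = det (mat (a + b) (a + b) (\<lambda>(k, l). t k \<bullet> v i j l))" for i j
  have "rank_le I ((a + b) choose a) F"
  proof -
    have "(\<lambda>(k, l). if l < a then t k \<bullet> u i l else t k \<bullet> w j (l - a)) = (\<lambda>(k, l). t k \<bullet> v i j l)"
      for i j by (auto simp: v_def fun_eq_iff)
    then show ?thesis
      using det_blocks_rank_le[of I a b "\<lambda>i k l. t k \<bullet> u i l" "\<lambda>j k l. t k \<bullet> w j (l - a)"]
      unfolding F_def by simp
  qed
  moreover have "F i i \<noteq> 0" if i: "i \<in> I" for i
  proof
    assume "F i i = 0"
    \<comment> \<open>A kernel vector yields \<open>x + y\<close> in \<open>E i\<close> with
      projection 0, hence \<open>x = - y\<close> lies in both spaces and vanishes; independence of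
      the two bases then kills \<open>c\<close>.\<close>
    then obtain c where c: "\<exists>l<a + b. c l \<noteq> 0"
      "\<forall>k<a + b. t k \<bullet> (\<Sum>l<a + b. c l *\<^sub>R v i i l) = 0"
      unfolding F_def det_inner_eq_0_iff by blast
    define x where "x = (\<Sum>l<a. c l *\<^sub>R u i l)"
    define y where "y = (\<Sum>l<b. c (a + l) *\<^sub>R w i l)"
    have x: "x \<in> U i" unfolding x_def by (rule inU[OF i])
    have y: "y \<in> W i" unfolding y_def by (rule inW[OF i])
    have xy: "x + y = 0" using t[OF i x y] c(2) unfolding comb x_def y_def .
    then have "x = - y" by (rule eq_neg_iff_add_eq_0[THEN iffD2])
    then have "x \<in> U i \<inter> W i" using x y subspace_neg[OF W(1)[OF i]] by simp
    then have "x = 0" using disj[OF i] by blast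
    moreover from this have "y = 0" using xy by simp
    ultimately have "\<forall>l<a. c l = 0" "\<forall>l<b. c (a + l) = 0"
      unfolding x_def y_def using U0[OF i, of c] W0[OF i, of "\<lambda>l. c (a + l)"] by simp_all
    then have "c l = 0" if "l < a + b" for l
      using that by (metis add_diff_inverse_nat nat_add_left_cancel_less)
    then show False using c(1) by blast
  qed
  moreover have "F i j = 0" if ij: "i \<in> I" "j \<in> I" and meet: "\<not> U i \<inter> W j \<subseteq> {0}" for i j
  proof -
    obtain x where x: "x \<in> U i" "x \<in> W j" "x \<noteq> 0" using meet by blast
    obtain \<alpha> where \<alpha>: "x = (\<Sum>l<a. \<alpha> l *\<^sub>R u i l)" using bspec[OF u ij(1)] x(1) by blast
    obtain \<beta> where \<beta>: "x = (\<Sum>l<b. \<beta> l *\<^sub>R w j l)" using bspec[OF w ij(2)] x(2) by blast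
    \<comment> \<open>The two expansions of the common vector \<open>x\<close> are subtracted; the
      relation is nontrivial since \<open>x\<close> is nonzero.\<close>
    define c where "c l = (if l < a then \<alpha> l else - \<beta> (l - a))" for l
    have "(\<Sum>l<a + b. c l *\<^sub>R v i j l) = 0"
      unfolding comb using \<alpha> \<beta> by (simp add: c_def sum_negf)
    moreover have "\<exists>l<a + b. c l \<noteq> 0"
    proof (rule ccontr)
      assume "\<not> (\<exists>l<a + b. c l \<noteq> 0)"
      then have "\<forall>l<a. \<alpha> l = 0" unfolding c_def by (metis trans_less_add1)
      then show False using x(3) \<alpha> by simp
    qed
    ultimately show ?thesis
      unfolding F_def det_inner_eq_0_iff by (intro exI[of _ c]) simp
  qed
  ultimately show ?thesis by blast
qed

section \<open>Sums of subspaces\<close>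

lemma set_plus_eq: "S + T = {x + y | x y. x \<in> S \<and> y \<in> T}"
  by (auto simp: set_plus_def)

lemma subspace_sum_sets:
  fixes A :: "'k \<Rightarrow> 'v::real_vector set"
  assumes "\<And>k. k \<in> K \<Longrightarrow> subspace (A k)"
  shows "subspace (\<Sum>k\<in>K. A k)"
  using assms
  by (induction K rule: infinite_finite_induct)
    (auto simp: set_plus_eq set_zero intro: subspace_sums)

lemma subset_sum_sets:
  fixes A :: "'k \<Rightarrow> 'v::real_vector set"
  assumes "finite K" "q \<in> K" "\<And>k. k \<in> K \<Longrightarrow> subspace (A k)"
  shows "A q \<subseteq> (\<Sum>k\<in>K. A k)"
proof
  fix x assume "x \<in> A q"
  moreover have "0 \<in> (\<Sum>k\<in>K - {q}. A k)"
    using assms(3) by (intro subspace_0 subspace_sum_sets) simp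
  ultimately have "x + 0 \<in> A q + (\<Sum>k\<in>K - {q}. A k)" by (rule set_plus_intro)
  then show "x \<in> (\<Sum>k\<in>K. A k)"
    unfolding sum.remove[OF assms(1,2)] by simp
qed

lemma dim_set_plus_Int:
  fixes S T :: "'v::euclidean_space set"
  assumes "subspace S" "subspace T"
  shows "dim (S + T) + dim (S \<inter> T) = dim S + dim T"
  unfolding set_plus_eq by (rule dim_sums_Int[OF assms])

lemma dim_sum_sets_le:
  fixes A :: "'k \<Rightarrow> 'v::euclidean_space set"
  assumes "finite K" "\<And>k. k \<in> K \<Longrightarrow> subspace (A k)"
  shows "dim (\<Sum>k\<in>K. A k) \<le> (\<Sum>k\<in>K. dim (A k))"
  using assms
proof (induction K rule: finite_induct)
  case empty
  show ?case by (simp add: set_zero)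
next
  case (insert q K)
  have "dim (A q + (\<Sum>k\<in>K. A k)) \<le> dim (A q) + dim (\<Sum>k\<in>K. A k)"
    using dim_set_plus_Int[of "A q" "\<Sum>k\<in>K. A k"] insert.prems subspace_sum_sets[of K A]
    by fastforce
  then show ?case using insert by fastforce
qed

text \<open>Directness passes to subfamilies: the parts over \<open>J\<close> and
  \<open>K - J\<close> have at most the expected dimensions, so a full total forces equality in
  both.\<close>

lemma dim_sum_sets_subset:
  fixes A :: "'k \<Rightarrow> 'v::euclidean_space set"
  assumes "finite K" "J \<subseteq> K" "\<And>k. k \<in> K \<Longrightarrow> subspace (A k)"
    and "dim (\<Sum>k\<in>K. A k) = (\<Sum>k\<in>K. dim (A k))"
  shows "dim (\<Sum>k\<in>J. A k) = (\<Sum>k\<in>J. dim (A k))"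
proof -
  have sub: "subspace (\<Sum>k\<in>K - J. A k)" "subspace (\<Sum>k\<in>J. A k)"
    by (rule subspace_sum_sets, use assms(2,3) in blast)+
  have le: "dim (\<Sum>k\<in>K - J. A k) \<le> (\<Sum>k\<in>K - J. dim (A k))" "dim (\<Sum>k\<in>J. A k) \<le> (\<Sum>k\<in>J. dim (A k))"
    by (rule dim_sum_sets_le, use assms(1-3) in \<open>auto intro: finite_subset\<close>)+
  show ?thesis
    using assms(4) le dim_set_plus_Int[OF sub]
    unfolding sum.subset_diff[OF assms(2,1)] by linarith
qed

section \<open>The multinomial coefficient as a product of binomial coefficients\<close>

text \<open>Each binomial is a tail factorial divided by \<open>fact (a p)\<close> and the next tail
  factorial, so the product telescopes. The multiplied form avoids division; the variable lower end
  \<open>k\<close> serves the induction, which peels off the first index.\<close>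

lemma prod_binomial_tail_sums:
  fixes a :: "nat \<Rightarrow> nat"
  shows "(\<Prod>p = k..d. (a p + (\<Sum>q = Suc p..d. a q)) choose a p) * (\<Prod>p = k..d. fact (a p))
    = fact (\<Sum>p = k..d. a p)"
proof (induction "Suc d - k" arbitrary: k)
  case 0
  then show ?case by simp
next
  case (Suc n)
  then have kd: "k \<le> d" by simp
  let ?s = "\<Sum>q = Suc k..d. a q"
  have "fact (a k) * fact ?s * ((a k + ?s) choose a k) = (fact (a k + ?s) :: nat)"
    using binomial_fact_lemma[of "a k" "a k + ?s"] by simp
  moreover have "(\<Prod>p = Suc k..d. (a p + (\<Sum>q = Suc p..d. a q)) choose a p)
      * (\<Prod>p = Suc k..d. fact (a p)) = fact ?s"
    using Suc by (intro Suc(1)) simp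
  ultimately show ?case
    using kd by (simp add: prod.atLeast_Suc_atMost sum.atLeast_Suc_atMost ac_simps)
qed

text \<open>The factors on the right are the rank bounds of the matrices for the single
  \<open>p\<close>.\<close>

lemma multinomial_coeff_eq_prod:
  "multinomial_coeff d a = (\<Prod>p = 1..d. (a p + (\<Sum>q = Suc p..d. a q)) choose a p)"
proof -
  have "(\<Prod>p = 1..d. fact (a p)) \<noteq> (0::nat)" by simp
  then show ?thesis
    unfolding multinomial_coeff_def prod_binomial_tail_sums[of a d 1, symmetric]
    by (rule nonzero_mult_div_cancel_right)
qed

section \<open>The bound for skew systems of \<open>d\<close>-tuples\<close>

theorem theorem1p13:
  fixes d m :: nat
    and a :: "nat \<Rightarrow> nat"
    and A :: "nat \<Rightarrow> nat \<Rightarrow> (real ^ 'n) set"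
  assumes "d \<ge> 1"
    and "\<And>i k. i \<in> {1..m} \<Longrightarrow> k \<in> {1..d} \<Longrightarrow> subspace (A i k)"
    and "\<And>i k. i \<in> {1..m} \<Longrightarrow> k \<in> {1..d} \<Longrightarrow> dim (A i k) = a k"
    and "\<And>i. i \<in> {1..m} \<Longrightarrow> dim (\<Sum>k = 1..d. A i k) = (\<Sum>k = 1..d. dim (A i k))"
    and "\<And>i j. i \<in> {1..m} \<Longrightarrow> j \<in> {1..m} \<Longrightarrow> i < j \<Longrightarrow>
           \<exists>p\<in>{1..d}. \<exists>q\<in>{1..d}. p < q \<and> A i p \<inter> A j q \<noteq> {0}"
  shows "m \<le> multinomial_coeff d a"
proof -
  note sub = assms(2) and dims = assms(3) and direct = assms(4) and meet = assms(5)
  \<comment> \<open>For \<open>p = d\<close> the sum is empty, which is the zero space, and the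
    corresponding binomial coefficient is 1.\<close>
  define T where "T p i = (\<Sum>q = Suc p..d. A i q)" for p i
  have "\<forall>p\<in>{1..d}. \<exists>F. rank_le {1..m} ((a p + (\<Sum>q = Suc p..d. a q)) choose a p) F \<and>
      (\<forall>i\<in>{1..m}. F i i \<noteq> 0) \<and>
      (\<forall>i\<in>{1..m}. \<forall>j\<in>{1..m}. \<not> A i p \<inter> T p j \<subseteq> {0} \<longrightarrow> F i j = 0)"
  proof
    fix p assume p: "p \<in> {1..d}"
    have subT: "subspace (T p i)" if "i \<in> {1..m}" for i
      unfolding T_def using that by (intro subspace_sum_sets sub) auto
    have dimT: "dim (T p i) = (\<Sum>q = Suc p..d. a q)" if i: "i \<in> {1..m}" for i
    proof -
      have "dim (T p i) = (\<Sum>q = Suc p..d. dim (A i q))"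
        unfolding T_def
        by (rule dim_sum_sets_subset[OF _ _ sub[OF i] direct[OF i]]) auto
      also have "\<dots> = (\<Sum>q = Suc p..d. a q)"
        using dims[OF i] by (intro sum.cong) auto
      finally show ?thesis .
    qed
    show "\<exists>F. rank_le {1..m} ((a p + (\<Sum>q = Suc p..d. a q)) choose a p) F \<and>
      (\<forall>i\<in>{1..m}. F i i \<noteq> 0) \<and>
      (\<forall>i\<in>{1..m}. \<forall>j\<in>{1..m}. \<not> A i p \<inter> T p j \<subseteq> {0} \<longrightarrow> F i j = 0)"
    proof (rule bollobas_pair_matrix)
      fix i assume i: "i \<in> {1..m}"
      have pd: "p \<le> d" using p by simp
      \<comment> \<open>Directness passes to the tail \<open>{p..d}\<close>, so the dimensions of
        \<open>A i p\<close> and \<open>T p i\<close> add up and the dimension formula leaves a zero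
        intersection.\<close>
      have "dim (\<Sum>q = p..d. A i q) = (\<Sum>q = p..d. dim (A i q))"
        using p by (intro dim_sum_sets_subset[OF _ _ sub[OF i] direct[OF i]]) auto
      then have "dim (A i p + T p i) = (\<Sum>q = p..d. dim (A i q))"
        unfolding T_def sum.atLeast_Suc_atMost[OF pd, of "A i"] .
      also have "\<dots> = (\<Sum>q = p..d. a q)"
        using p dims[OF i] by (intro sum.cong) auto
      also have "\<dots> = a p + (\<Sum>q = Suc p..d. a q)"
        by (rule sum.atLeast_Suc_atMost[OF pd])
      finally have "dim (A i p \<inter> T p i) = 0"
        using dim_set_plus_Int[OF sub[OF i p] subT[OF i]] dims[OF i p] dimT[OF i] by linarith
      then show "A i p \<inter> T p i \<subseteq> {0}" by (rule dim_eq_0[THEN iffD1])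
    qed (use sub dims subT dimT p in auto)
  qed
  then obtain F where F: "\<forall>p\<in>{1..d}. rank_le {1..m} ((a p + (\<Sum>q = Suc p..d. a q)) choose a p) (F p) \<and>
      (\<forall>i\<in>{1..m}. F p i i \<noteq> 0) \<and>
      (\<forall>i\<in>{1..m}. \<forall>j\<in>{1..m}. \<not> A i p \<inter> T p j \<subseteq> {0} \<longrightarrow> F p i j = 0)"
    by (rule bchoice[THEN exE])
  have "rank_le {1..m} (multinomial_coeff d a) (\<lambda>i j. \<Prod>p = 1..d. F p i j)"
    unfolding multinomial_coeff_eq_prod using F by (intro rank_le_prod) auto
  then show ?thesis
  proof (rule triangular_rank_ge)
    fix i j assume ij: "i \<in> {1..m}" "j \<in> {1..m}" "i < j"
    obtain p q where pq: "p \<in> {1..d}" "q \<in> {1..d}" "p < q" "A i p \<inter> A j q \<noteq> {0}"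
      using meet[OF ij] by blast
    \<comment> \<open>All \<open>A j q\<close> with \<open>q > p\<close> lie in
      \<open>T p j\<close>, so the factor at this \<open>p\<close> vanishes and with it the
      product.\<close>
    have "A j q \<subseteq> T p j"
      unfolding T_def using pq sub[OF ij(2)] by (intro subset_sum_sets) auto
    \<comment> \<open>Differing from \<open>{0}\<close> yields a nonzero common vector only once the
      empty set is ruled out.\<close>
    moreover have "0 \<in> A i p \<inter> A j q"
      using sub ij pq by (simp add: subspace_0)
    ultimately have "\<not> A i p \<inter> T p j \<subseteq> {0}" using pq(4) by blast
    then have "F p i j = 0" using F pq(1) ij by blast
    then show "(\<Prod>p = 1..d. F p i j) = 0" using pq(1) by (intro prod_zero) auto
  next
    show "(\<Prod>p = 1..d. F p i i) \<noteq> 0" if "i \<in> {1..m}" for i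
      using F that by (subst prod_zero_iff) auto
  qed
qed

end
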